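(* Let $p\ge1$, let $X:\triangle\to\mathcal G^{\lfloor p\rfloor}$ be a branched $p$-rough path over $\mathbb R^d$, and let $\bar X=\Psi(X):\triangle\to T^{(\Pi,1)}(B_k)$ be the corresponding weakly geometric $\Pi$-rough path, where $\Psi:\mathcal H^{\lfloor p\rfloor}\to T^{(\Pi,1)}(B_k)$ is the algebra isomorphism $\tau_{r_1}\star\cdots\star\tau_{r_m}\mapsto \tau_{r_1}\dot\otimes\cdots\dot\otimes\tau_{r_m}$. Let $f=(f_1,\dots,f_d)$ be bounded smooth vector fields on $\mathbb R^e$ with bounded derivatives of all orders, and define the vector fields $\bar f=(\bar f_1,\dots,\bar f_k)=(f_{\tau_1},\dots,f_{\tau_k})$ on $\mathbb R^e$, where $\tau\mapsto f_\tau$ is the pre-Lie algebra morphism $\mathcal B\to C^\infty(\mathbb R^e,\mathbb R^e)$ with $f_{\bullet_i}=f_i$. Then, for a common initial condition $y\in\mathbb R^e$, the unique solutions to the (branched) RDE $\mathrm dY=f(Y)\,\mathrm dX$ and the (geometric) RDE $\mathrm d\bar Y=\bar f(\bar Y)\,\mathrm d\bar X$ coincide.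
   Context: **Trees and the Grossman–Larson algebra.** Fix $d\ge1$. A *tree* is a (non-empty, finite) rooted tree with nodes labelled by $\{1,\dots,d\}$ (up to isomorphism); a *forest* is a finite multiset of trees, including the empty forest $\mathbf 1$; $\sigma_1\sigma_2$ denotes multiset union. $\mathcal T,\mathcal F$ are the sets of trees and forests, $|\sigma|$ is the number of nodes, $\mathcal B,\mathcal H$ are the real linear spans of $\mathcal T,\mathcal F$, and $\mathcal H^*$ is the space of formal series $\sum_{\sigma\in\mathcal F}\lambda_\sigma\sigma$; $\langle h,\sigma\rangle$ denotes the coefficient of $\sigma$ in $h$. $[\sigma_1\dots\sigma_n]_i$ is the tree obtained by attaching trees $\sigma_1,\dots,\sigma_n$ to a root labelled $i$ ($\bullet_i$ if $n=0$). The Connes–Kreimer coproduct $\Delta_{CK}:\mathcal H\to\mathcal H\otimes\mathcal H$ is the linear map multiplicative for juxtaposition of forests with $\Delta_{CK}\mathbf 1=\mathbf 1\otimes\mathbf 1$ and $\Delta_{CK}[\sigma_1\dots\sigma_n]_i=[\sigma_1\dots\sigma_n]_i\otimes\mathbf 1+(\mathrm{id}\otimes B_+^i)(\Delta_{CK}\sigma_1\cdots\Delta_{CK}\sigma_n)$, where $B^i_+(\tau_1\cdots\tau_m)=[\tau_1\dots\tau_m]_i$. The Grossman–Larson product $\star$ is dual to it: $\langle\sigma_1\star\sigma_2,\sigma\rangle$ is the coefficient of $\sigma_1\otimes\sigma_2$ in $\Delta_{CK}\sigma$. The coproduct is $\delta(\sigma)=\sum_{(\sigma_1,\sigma_2):\sigma_1\sigma_2=\sigma}\sigma_1\otimes\sigma_2$.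 Both extend to formal series. $\mathcal G^*=\{g\in\mathcal H^*: \delta g=g\otimes g,\ g\ne0\}$. $\mathcal H^N$ is the quotient of $\mathcal H^*$ by the ideal of series in forests with more than $N$ nodes, $\rho^N:\mathcal H^*\to\mathcal H^N$ the projection, $\mathcal G^N=\rho^N(\mathcal G^* )$; $\mathcal H^N$ has the inner product making $\{\sigma\in\mathcal F:|\sigma|\le N\}$ orthonormal. $\pi^n$ is the projection $\sum\lambda_\sigma\sigma\mapsto\sum_{|\sigma|=n}\lambda_\sigma\sigma$. **Branched rough paths.** $\triangle=\{(s,t):0\le s\le t\le1\}$. A *control* is a continuous $\omega:\triangle\to[0,\infty)$ with $\omega(s,u)+\omega(u,t)\le\omega(s,t)$. A *branched $p$-rough path* is a continuous $X:\triangle\to\mathcal G^{\lfloor p\rfloor}$ with $X_{s,u}\star X_{u,t}=X_{s,t}$ and, for some control $\omega$, $|\pi^nX_{s,t}|\le\omega(s,t)^{n/p}$ for $n=1,\dots,\lfloor p\rfloor$. **Free generators (known theorem of Foissy and Chapoton).** There is a subspace $B\subset\mathcal B$ such that $(\mathcal H,\star,\delta)$ is isomorphic as a Hopf algebra to the tensor Hopf algebra $T(B)$ (via the algebra morphism extending $B\subset\mathcal H$). Fix such $B$ with a basis $\tau_1,\tau_2,\dots$ of trees in $\mathcal T$ with $|\tau_i|\le|\tau_j|$ for $i<j$. **$\Pi$-rough paths over $B_k$.** Let $k\ge1$ be the largest integer with $|\tau_k|\le p$, $B^j=\mathrm{span}(\tau_j)$, $B_k=B^1\oplus\cdots\oplus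 B^k$, $p_j=p/|\tau_j|$, $\Pi=(p_1,\dots,p_k)$. For a multi-index $R=(r_1,\dots,r_m)\in\{1,\dots,k\}^m$, $m\ge0$, put $\deg_\Pi(R)=\sum_j|\tau_{r_j}|/p$, and let $\pi_R:T((B_k))=\prod_{m\ge0}B_k^{\otimes m}\to B^{r_1}\otimes\cdots\otimes B^{r_m}$ be the projection. $\mathcal A^\Pi_1$ is the set of multi-indices with $\deg_\Pi(R)\le1$; $T^{(\Pi,1)}(B_k)$ is the quotient algebra of $(T((B_k)),\dot\otimes)$ ($\dot\otimes$ the tensor product multiplication) by the ideal $\{v:\pi_R(v)=0\ \forall R\in\mathcal A^\Pi_1\}$. $G^{(\Pi,1)}(B_k)$ is the exponential of the Lie subalgebra generated by $B_k$. A *weakly geometric $\Pi$-rough path* is a continuous map $\bar X:\triangle\to G^{(\Pi,1)}(B_k)$ with $\bar X_{s,u}\dot\otimes\bar X_{u,t}=\bar X_{s,t}$ and, for some control $\omega$, $|\pi_R(\bar X_{s,t})|\le\omega(s,t)^{\deg_\Pi(R)}$ for all non-empty $R\in\mathcal A_1^\Pi$. $\langle\bar X_{s,t},\tau_{r_1}\dot\otimes\cdots\dot\otimes\tau_{r_m}\rangle$ is the coefficient of $\bar X_{s,t}$ on that basis element. **Pre-Lie structures.** For $\tau,\sigma\in\mathcal B$, $\tau\curvearrowright\sigma=\pi_{\mathcal B}(\tau\star\sigma)$, where $\pi_{\mathcal B}:\mathcal H\to\mathcal B$ is the projection (killing forests that are not single trees); explicitly, for trees, $\tau\curvearrowright\sigma=\sum_{\bar\tau\in\mathcal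 T}n(\tau,\sigma,\bar\tau)\bar\tau$ with $n(\tau,\sigma,\bar\tau)$ the number of edges of $\bar\tau$ whose removal leaves the branch (part not containing the root) $\tau$ and the trunk $\sigma$. $(\mathcal B,\curvearrowright)$ is the free pre-Lie algebra on $\bullet_1,\dots,\bullet_d$ (Chapoton–Livernet). On $C^\infty(\mathbb R^e,\mathbb R^e)$, $f\triangleleft g=\sum_{i=1}^ef^i\partial_ig$. $\tau\mapsto f_\tau$ is the unique linear map with $f_{\tau\curvearrowright\sigma}=f_\tau\triangleleft f_\sigma$ and $f_{\bullet_i}=f_i$. **Solutions of RDEs.** Solutions are understood via the Euler estimates which characterise them. $Y:[0,1]\to\mathbb R^e$ solves $\mathrm dY=f(Y)\mathrm dX$, $Y_0=y$, if it is the unique path with $Y_0=y$ and $$Y_t-Y_s=\sum_{\tau\in\mathcal T,\ |\tau|\le\lfloor p\rfloor}\langle X_{s,t},\tau\rangle f_\tau(Y_s)+o(\omega(s,t)).$$ $\bar Y$ solves $\mathrm d\bar Y=\bar f(\bar Y)\mathrm d\bar X$, $\bar Y_0=y$, if it is the unique path with $\bar Y_0=y$ and $$\bar Y_t-\bar Y_s=\sum_{(r_1,\dots,r_m)\in\mathcal A_1^\Pi,\ m\ge1}(\bar f_{r_1}\cdots\bar f_{r_m}I)(\bar Y_s)\,\langle\bar X_{s,t},\tau_{r_1}\dot\otimes\cdots\dot\otimes\tau_{r_m}\rangle+o(\omega(s,t)),$$ where $I$ is the identity map of $\mathbb R^e$ and each vector field acts as the first-order differential operator $g\mapsto\sum_i\bar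 f_r^i\partial_ig$ (composed, $\bar f_{r_m}$ acting first). Here $\omega$ is a control on the $p$-variation of $X$ and the $\Pi$-variation of $\bar X$ in the sense of the definitions above, and $o(\omega(s,t))$ denotes a term bounded by $\theta(\omega(s,t))$ for some function $\theta$ with $\theta(x)/x\to0$ as $x\to0$. *)

theory Defs
  imports "HOL-Analysis.Analysis" "HOL-Library.Multiset" "HOL-Library.Poly_Mapping"
begin

section \<open>Labelled rooted trees and forests\<close>

text \<open>
  Nodes are labelled by a finite type \<open>'d\<close>, which plays the role of \<open>{1,\<dots>,d}\<close>.
  Since the children of a node form a multiset, trees are non-planar, i.e. already taken
  up to isomorphism. \<open>Node i F\<close> is the tree \<open>[F]\<^sub>i\<close>.
\<close>

datatype 'd rtree = Node 'd "'d rtree multiset"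

type_synonym 'd forest = "'d rtree multiset"

primrec nodes :: "'d rtree \<Rightarrow> nat" where
  "nodes (Node i F) = 1 + \<Sum>\<^sub># (image_mset nodes F)"

definition fnodes :: "'d forest \<Rightarrow> nat" where
  "fnodes F = \<Sum>\<^sub># (image_mset nodes F)"

lemma nodes_pos: "nodes t \<ge> 1"
  by (cases t) simp

lemma nodes_le_fnodes: "t \<in># F \<Longrightarrow> nodes t \<le> fnodes F"
  by (auto simp: fnodes_def dest!: multi_member_split)

lemma size_le_fnodes: "size F \<le> fnodes F"
proof (induction F)
  case (add t F)
  then show ?case using nodes_pos[of t] by (simp add: fnodes_def)
qed simp

text \<open>
  Finiteness of the index sets over which sums are taken below.
\<close>

lemma finite_bounded_multisets:
  assumes "finite A"
  shows "finite {M. set_mset M \<subseteq> A \<and> size M \<le> n}"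
proof (rule finite_subset)
  show "{M. set_mset M \<subseteq> A \<and> size M \<le> n} \<subseteq> mset ` {xs. set xs \<subseteq> A \<and> length xs \<le> n}"
  proof
    fix M assume M: "M \<in> {M. set_mset M \<subseteq> A \<and> size M \<le> n}"
    obtain xs where "mset xs = M" using ex_mset by blast
    with M show "M \<in> mset ` {xs. set xs \<subseteq> A \<and> length xs \<le> n}" by auto
  qed
  show "finite (mset ` {xs. set xs \<subseteq> A \<and> length xs \<le> n})"
    using assms by (intro finite_imageI finite_lists_length_le)
qed

lemma finite_trees: "finite {t :: 'd::finite rtree. nodes t \<le> N}"
proof (induction N)
  case 0
  have "\<not> nodes t \<le> 0" for t :: "'d rtree" using nodes_pos[of t] by linarith
  then have "{t :: 'd rtree. nodes t \<le> 0} = {}" by blast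
  then show ?case by (metis finite.emptyI)
next
  case (Suc N)
  let ?A = "{F :: 'd forest. set_mset F \<subseteq> {t. nodes t \<le> N} \<and> size F \<le> N}"
  have "{t :: 'd rtree. nodes t \<le> Suc N} \<subseteq> (\<lambda>(i, F). Node i F) ` (UNIV \<times> ?A)"
  proof
    fix t :: "'d rtree" assume "t \<in> {t. nodes t \<le> Suc N}"
    moreover obtain i F where t: "t = Node i F" by (cases t)
    ultimately have "fnodes F \<le> N" by (simp add: fnodes_def)
    then have "F \<in> ?A"
      using nodes_le_fnodes[of _ F] size_le_fnodes[of F] by (auto intro: order_trans)
    then show "t \<in> (\<lambda>(i, F). Node i F) ` (UNIV \<times> ?A)" using t by auto
  qed
  then show ?case
    using finite_bounded_multisets[OF Suc.IH, of N] by (auto intro: finite_subset)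
qed

lemma finite_forests: "finite {F :: 'd::finite forest. fnodes F \<le> N}"
proof (rule finite_subset)
  show "{F :: 'd forest. fnodes F \<le> N} \<subseteq> {F. set_mset F \<subseteq> {t. nodes t \<le> N} \<and> size F \<le> N}"
    using nodes_le_fnodes size_le_fnodes by (auto intro: order_trans)
qed (rule finite_bounded_multisets[OF finite_trees])


section \<open>The Grossman--Larson algebra\<close>

text \<open>
  \<open>\<H> \<otimes> \<H>\<close> is the type of finitely supported functions on pairs of forests. The ring
  multiplication of \<^typ>\<open>'a \<Rightarrow>\<^sub>0 real\<close> is convolution with respect to addition of keys; for
  pairs of multisets this is componentwise juxtaposition of forests.
\<close>

definition id_tensor_B ::
  "'d \<Rightarrow> ('d forest \<times> 'd forest \<Rightarrow>\<^sub>0 real) \<Rightarrow> ('d forest \<times> 'd forest \<Rightarrow>\<^sub>0 real)" where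
  "id_tensor_B i P =
     (\<Sum>(a, b) \<in> Poly_Mapping.keys P.
        Poly_Mapping.single (a, {#Node i b#}) (Poly_Mapping.lookup P (a, b)))"

primrec CK_tree :: "'d rtree \<Rightarrow> ('d forest \<times> 'd forest \<Rightarrow>\<^sub>0 real)" where
  "CK_tree (Node i F) =
     Poly_Mapping.single ({#Node i F#}, {#}) 1 + id_tensor_B i (\<Prod>\<^sub># (image_mset CK_tree F))"

definition CK :: "'d forest \<Rightarrow> ('d forest \<times> 'd forest \<Rightarrow>\<^sub>0 real)" where
  "CK F = \<Prod>\<^sub># (image_mset CK_tree F)"

text \<open>Formal series (elements of \<open>\<H>\<^sup>*\<close>) are given by their coefficients.\<close>

type_synonym 'd series = "'d forest \<Rightarrow> real"

definition ser :: "'d forest \<Rightarrow> 'd series" where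
  "ser F = (\<lambda>G. if G = F then 1 else 0)"

definition star :: "'d series \<Rightarrow> 'd series \<Rightarrow> 'd series" (infixl "\<star>" 70) where
  "g \<star> h = (\<lambda>F. \<Sum>(a, b) \<in> Poly_Mapping.keys (CK F).
                  Poly_Mapping.lookup (CK F) (a, b) * (g a * h b))"

text \<open>
  The coefficient of \<open>a \<otimes> b\<close> in \<open>\<delta> F\<close> is \<open>1\<close> if \<open>a b = F\<close> and \<open>0\<close> otherwise, so the coefficient
  of \<open>a \<otimes> b\<close> in \<open>\<delta> h\<close> is the coefficient of \<open>a b\<close> in \<open>h\<close>.
\<close>

definition delta :: "'d series \<Rightarrow> ('d forest \<times> 'd forest \<Rightarrow> real)" where
  "delta h = (\<lambda>(a, b). h (a + b))"

definition tensor :: "'d series \<Rightarrow> 'd series \<Rightarrow> ('d forest \<times> 'd forest \<Rightarrow> real)" where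
  "tensor g h = (\<lambda>(a, b). g a * h b)"

definition H_fin :: "'d series set" where
  "H_fin = {h. finite {F. h F \<noteq> 0}}"

definition B_trees :: "'d series set" where
  "B_trees = {h \<in> H_fin. \<forall>F. h F \<noteq> 0 \<longrightarrow> (\<exists>t. F = {#t#})}"

definition G_star :: "'d series set" where
  "G_star = {g. delta g = tensor g g \<and> g \<noteq> (\<lambda>_. 0)}"

text \<open>
  The quotient \<open>\<H>\<^sup>N\<close> is represented by the series without terms of more than \<open>N\<close> nodes;
  its product is \<open>rho N (g \<star> h)\<close>.
\<close>

definition rho :: "nat \<Rightarrow> 'd series \<Rightarrow> 'd series" where
  "rho N h = (\<lambda>F. if fnodes F \<le> N then h F else 0)"

definition H_trunc :: "nat \<Rightarrow> 'd series set" where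
  "H_trunc N = range (rho N)"

definition G_trunc :: "nat \<Rightarrow> 'd series set" where
  "G_trunc N = rho N ` G_star"

definition norm_H :: "nat \<Rightarrow> 'd::finite series \<Rightarrow> real" where
  "norm_H N h = sqrt (\<Sum>F | fnodes F \<le> N. (h F)\<^sup>2)"

definition grade_proj :: "nat \<Rightarrow> 'd series \<Rightarrow> 'd series" where
  "grade_proj n h = (\<lambda>F. if fnodes F = n then h F else 0)"


section \<open>Branched rough paths\<close>

definition time_triangle :: "(real \<times> real) set" where
  "time_triangle = {(s, t). 0 \<le> s \<and> s \<le> t \<and> t \<le> 1}"

definition control :: "(real \<Rightarrow> real \<Rightarrow> real) \<Rightarrow> bool" where
  "control \<omega> \<longleftrightarrow>
     continuous_on time_triangle (\<lambda>(s, t). \<omega> s t) \<and>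
     (\<forall>(s, t) \<in> time_triangle. 0 \<le> \<omega> s t) \<and>
     (\<forall>s u t. 0 \<le> s \<longrightarrow> s \<le> u \<longrightarrow> u \<le> t \<longrightarrow> t \<le> 1 \<longrightarrow> \<omega> s u + \<omega> u t \<le> \<omega> s t)"

definition controls_p_variation ::
  "real \<Rightarrow> (real \<Rightarrow> real \<Rightarrow> 'd::finite series) \<Rightarrow> (real \<Rightarrow> real \<Rightarrow> real) \<Rightarrow> bool" where
  "controls_p_variation p X \<omega> \<longleftrightarrow>
     control \<omega> \<and>
     (\<forall>(s, t) \<in> time_triangle. \<forall>n \<in> {1..nat \<lfloor>p\<rfloor>}.
        norm_H (nat \<lfloor>p\<rfloor>) (grade_proj n (X s t)) \<le> \<omega> s t powr (real n / p))"

text \<open>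
  Continuity refers to the topology of coefficientwise convergence, which on the
  finite-dimensional space \<^term>\<open>H_trunc N\<close> is the norm topology. The same remark applies to
  \<open>\<Pi>\<close>-rough paths below.
\<close>

definition branched_rough_path :: "real \<Rightarrow> (real \<Rightarrow> real \<Rightarrow> 'd::finite series) \<Rightarrow> bool" where
  "branched_rough_path p X \<longleftrightarrow>
     (\<forall>(s, t) \<in> time_triangle. X s t \<in> G_trunc (nat \<lfloor>p\<rfloor>)) \<and>
     continuous_on time_triangle (\<lambda>(s, t). X s t) \<and>
     (\<forall>s u t. 0 \<le> s \<longrightarrow> s \<le> u \<longrightarrow> u \<le> t \<longrightarrow> t \<le> 1 \<longrightarrow>
        rho (nat \<lfloor>p\<rfloor>) (X s u \<star> X u t) = X s t) \<and>
     (\<exists>\<omega>. controls_p_variation p X \<omega>)"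


section \<open>Free generators\<close>

text \<open>
  The generators \<open>\<tau>\<^sub>1, \<tau>\<^sub>2, \<dots>\<close> are the values of \<open>\<tau>\<close> at positive arguments (\<open>\<tau> 0\<close> is ignored), and
  \<open>B\<close> is their span. An element of the tensor algebra over \<open>B\<close>, of its completion, or of one of
  its quotients, is given by its coefficients with respect to the basis
  \<open>\<tau>\<^sub>r\<^sub>1 \<otimes> \<dots> \<otimes> \<tau>\<^sub>r\<^sub>m\<close>, which is indexed by the word \<open>[r\<^sub>1, \<dots>, r\<^sub>m]\<close>.
\<close>

type_synonym words = "nat list \<Rightarrow> real"

definition word :: "nat list \<Rightarrow> words" where
  "word R = (\<lambda>S. if S = R then 1 else 0)"

definition tens :: "words \<Rightarrow> words \<Rightarrow> words" where
  "tens u v = (\<lambda>R. \<Sum>i\<le>length R. u (take i R) * v (drop i R))"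

definition tensor_algebra :: "words set" where
  "tensor_algebra = {c. finite {R. c R \<noteq> 0} \<and> {R. c R \<noteq> 0} \<subseteq> lists {1..}}"

definition star_word :: "(nat \<Rightarrow> 'd rtree) \<Rightarrow> nat list \<Rightarrow> 'd series" where
  "star_word \<tau> R = foldr (\<lambda>r h. ser {#\<tau> r#} \<star> h) R (ser {#})"

text \<open>The algebra morphism from the tensor algebra to \<open>(\<H>, \<star>)\<close> extending the inclusion of \<open>B\<close>.\<close>

definition tensor_to_H :: "(nat \<Rightarrow> 'd rtree) \<Rightarrow> words \<Rightarrow> 'd series" where
  "tensor_to_H \<tau> c = (\<lambda>F. \<Sum>R | c R \<noteq> 0. c R * star_word \<tau> R F)"

text \<open>
  The fourth clause says that the map intertwines \<open>\<delta>\<close> and the coproduct of the tensor Hopf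
  algebra, i.e. the multiplicative coproduct for which the elements of \<open>B\<close> are primitive; on
  the word \<open>R\<close> it is the sum, over all sets \<open>S\<close> of positions, of the subword of \<open>R\<close> at \<open>S\<close>
  tensor the complementary subword. The fifth clause is compatibility with the counits.
\<close>

definition tensor_hopf_iso :: "(nat \<Rightarrow> 'd rtree) \<Rightarrow> bool" where
  "tensor_hopf_iso \<tau> \<longleftrightarrow>
     bij_betw (tensor_to_H \<tau>) tensor_algebra H_fin \<and>
     tensor_to_H \<tau> (word []) = ser {#} \<and>
     (\<forall>c \<in> tensor_algebra. \<forall>c' \<in> tensor_algebra.
        tensor_to_H \<tau> (tens c c') = tensor_to_H \<tau> c \<star> tensor_to_H \<tau> c') \<and>
     (\<forall>c \<in> tensor_algebra.
        delta (tensor_to_H \<tau> c) =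
          (\<lambda>q. \<Sum>R | c R \<noteq> 0. \<Sum>S \<in> Pow {..<length R}.
             c R * tensor (star_word \<tau> (nths R S)) (star_word \<tau> (nths R (- S))) q)) \<and>
     (\<forall>c \<in> tensor_algebra. tensor_to_H \<tau> c {#} = c [])"

definition free_generators :: "(nat \<Rightarrow> 'd rtree) \<Rightarrow> bool" where
  "free_generators \<tau> \<longleftrightarrow>
     inj_on \<tau> {1..} \<and>
     (\<forall>i j. 1 \<le> i \<longrightarrow> i < j \<longrightarrow> nodes (\<tau> i) \<le> nodes (\<tau> j)) \<and>
     tensor_hopf_iso \<tau>"

definition is_cutoff :: "real \<Rightarrow> (nat \<Rightarrow> 'd rtree) \<Rightarrow> nat \<Rightarrow> bool" where
  "is_cutoff p \<tau> k \<longleftrightarrow>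
     1 \<le> k \<and> real (nodes (\<tau> k)) \<le> p \<and> (\<forall>j>k. p < real (nodes (\<tau> j)))"


section \<open>\<open>\<Pi>\<close>-rough paths over \<open>B\<^sub>k\<close>\<close>

definition deg_Pi :: "real \<Rightarrow> (nat \<Rightarrow> 'd rtree) \<Rightarrow> nat list \<Rightarrow> real" where
  "deg_Pi p \<tau> R = (\<Sum>r\<leftarrow>R. real (nodes (\<tau> r)) / p)"

definition A_Pi :: "real \<Rightarrow> (nat \<Rightarrow> 'd rtree) \<Rightarrow> nat \<Rightarrow> nat list set" where
  "A_Pi p \<tau> k = {R \<in> lists {1..k}. deg_Pi p \<tau> R \<le> 1}"

lemma finite_A_Pi:
  assumes "p > 0"
  shows "finite (A_Pi p \<tau> k)"
proof (rule finite_subset)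
  have len: "real (length R) \<le> p * deg_Pi p \<tau> R" for R
  proof (induction R)
    case (Cons r R)
    have "1 \<le> real (nodes (\<tau> r))" using nodes_pos[of "\<tau> r"] by simp
    with Cons show ?case using assms by (simp add: deg_Pi_def algebra_simps)
  qed (simp add: deg_Pi_def)
  show "A_Pi p \<tau> k \<subseteq> {R. set R \<subseteq> {1..k} \<and> length R \<le> nat \<lfloor>p\<rfloor>}"
  proof
    fix R assume R: "R \<in> A_Pi p \<tau> k"
    then have "p * deg_Pi p \<tau> R \<le> p * 1"
      using assms by (intro mult_left_mono) (auto simp: A_Pi_def)
    with len[of R] have "real (length R) \<le> p" by linarith
    then have "length R \<le> nat \<lfloor>p\<rfloor>" by (simp add: le_nat_floor)
    with R show "R \<in> {R. set R \<subseteq> {1..k} \<and> length R \<le> nat \<lfloor>p\<rfloor>}"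
      by (auto simp: A_Pi_def)
  qed
qed (simp add: finite_lists_length_le)

text \<open>
  The quotient \<open>T\<^bsup>(\<Pi>,1)\<^esup>(B\<^sub>k)\<close> is represented by the coefficient functions supported on the
  words in \<^const>\<open>A_Pi\<close>.
\<close>

definition T_Pi :: "real \<Rightarrow> (nat \<Rightarrow> 'd rtree) \<Rightarrow> nat \<Rightarrow> words set" where
  "T_Pi p \<tau> k = {v. \<forall>R. R \<notin> A_Pi p \<tau> k \<longrightarrow> v R = 0}"

definition trunc_Pi :: "real \<Rightarrow> (nat \<Rightarrow> 'd rtree) \<Rightarrow> nat \<Rightarrow> words \<Rightarrow> words" where
  "trunc_Pi p \<tau> k v = (\<lambda>R. if R \<in> A_Pi p \<tau> k then v R else 0)"

definition tens_Pi :: "real \<Rightarrow> (nat \<Rightarrow> 'd rtree) \<Rightarrow> nat \<Rightarrow> words \<Rightarrow> words \<Rightarrow> words" where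
  "tens_Pi p \<tau> k u v = trunc_Pi p \<tau> k (tens u v)"

inductive_set lie_Pi :: "real \<Rightarrow> (nat \<Rightarrow> 'd rtree) \<Rightarrow> nat \<Rightarrow> words set"
  for p :: real and \<tau> :: "nat \<Rightarrow> 'd rtree" and k :: nat where
  gen: "j \<in> {1..k} \<Longrightarrow> trunc_Pi p \<tau> k (word [j]) \<in> lie_Pi p \<tau> k"
| zero: "(\<lambda>_. 0) \<in> lie_Pi p \<tau> k"
| add: "u \<in> lie_Pi p \<tau> k \<Longrightarrow> v \<in> lie_Pi p \<tau> k \<Longrightarrow> (\<lambda>R. u R + v R) \<in> lie_Pi p \<tau> k"
| scale: "u \<in> lie_Pi p \<tau> k \<Longrightarrow> (\<lambda>R. a * u R) \<in> lie_Pi p \<tau> k"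
| bracket: "u \<in> lie_Pi p \<tau> k \<Longrightarrow> v \<in> lie_Pi p \<tau> k \<Longrightarrow>
    (\<lambda>R. tens_Pi p \<tau> k u v R - tens_Pi p \<tau> k v u R) \<in> lie_Pi p \<tau> k"

text \<open>Elements of \<^const>\<open>lie_Pi\<close> have no constant term, so the series below is a finite sum.\<close>

definition exp_Pi :: "real \<Rightarrow> (nat \<Rightarrow> 'd rtree) \<Rightarrow> nat \<Rightarrow> words \<Rightarrow> words" where
  "exp_Pi p \<tau> k u = (\<lambda>R. suminf (\<lambda>n. (tens_Pi p \<tau> k u ^^ n) (word []) R / fact n))"

definition G_Pi :: "real \<Rightarrow> (nat \<Rightarrow> 'd rtree) \<Rightarrow> nat \<Rightarrow> words set" where
  "G_Pi p \<tau> k = exp_Pi p \<tau> k ` lie_Pi p \<tau> k"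

text \<open>
  Each \<open>B\<^sup>r\<^sup>1 \<otimes> \<dots> \<otimes> B\<^sup>r\<^sup>m\<close> is one-dimensional, spanned by the unit vector
  \<open>\<tau>\<^sub>r\<^sub>1 \<otimes> \<dots> \<otimes> \<tau>\<^sub>r\<^sub>m\<close>; hence \<open>\<bar>\<pi>\<^sub>R(v)\<bar>\<close> is the absolute value of the coefficient \<open>v R\<close>.
\<close>

definition controls_Pi_variation ::
  "real \<Rightarrow> (nat \<Rightarrow> 'd rtree) \<Rightarrow> nat \<Rightarrow> (real \<Rightarrow> real \<Rightarrow> words) \<Rightarrow> (real \<Rightarrow> real \<Rightarrow> real) \<Rightarrow> bool" where
  "controls_Pi_variation p \<tau> k Xbar \<omega> \<longleftrightarrow>
     control \<omega> \<and>
     (\<forall>(s, t) \<in> time_triangle. \<forall>R \<in> A_Pi p \<tau> k - {[]}.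
        \<bar>Xbar s t R\<bar> \<le> \<omega> s t powr deg_Pi p \<tau> R)"

definition weakly_geometric_rough_path ::
  "real \<Rightarrow> (nat \<Rightarrow> 'd rtree) \<Rightarrow> nat \<Rightarrow> (real \<Rightarrow> real \<Rightarrow> words) \<Rightarrow> bool" where
  "weakly_geometric_rough_path p \<tau> k Xbar \<longleftrightarrow>
     (\<forall>(s, t) \<in> time_triangle. Xbar s t \<in> G_Pi p \<tau> k) \<and>
     continuous_on time_triangle (\<lambda>(s, t). Xbar s t) \<and>
     (\<forall>s u t. 0 \<le> s \<longrightarrow> s \<le> u \<longrightarrow> u \<le> t \<longrightarrow> t \<le> 1 \<longrightarrow>
        tens_Pi p \<tau> k (Xbar s u) (Xbar u t) = Xbar s t) \<and>
     (\<exists>\<omega>. controls_Pi_variation p \<tau> k Xbar \<omega>)"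

definition is_Psi ::
  "real \<Rightarrow> (nat \<Rightarrow> 'd rtree) \<Rightarrow> nat \<Rightarrow> ('d series \<Rightarrow> words) \<Rightarrow> bool" where
  "is_Psi p \<tau> k \<Psi> \<longleftrightarrow>
     (let N = nat \<lfloor>p\<rfloor> in
     bij_betw \<Psi> (H_trunc N) (T_Pi p \<tau> k) \<and>
     (\<forall>g \<in> H_trunc N. \<forall>h \<in> H_trunc N. \<forall>a b.
        \<Psi> (\<lambda>F. a * g F + b * h F) = (\<lambda>R. a * \<Psi> g R + b * \<Psi> h R)) \<and>
     (\<forall>g \<in> H_trunc N. \<forall>h \<in> H_trunc N.
        \<Psi> (rho N (g \<star> h)) = tens_Pi p \<tau> k (\<Psi> g) (\<Psi> h)) \<and>
     (\<forall>R \<in> lists {1..k}. \<Psi> (rho N (star_word \<tau> R)) = trunc_Pi p \<tau> k (word R)))"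


section \<open>Vector fields and pre-Lie structures\<close>

type_synonym 'e vfield = "real ^ 'e \<Rightarrow> real ^ 'e"

definition partial :: "'e::finite \<Rightarrow> 'e vfield \<Rightarrow> 'e vfield" where
  "partial i g = (\<lambda>x. frechet_derivative g (at x) (axis i 1))"

text \<open>
  \<open>g\<close> is \<open>C\<^sup>\<infinity>\<close> iff all its iterated partial derivatives exist and are differentiable (hence
  continuous).
\<close>

definition smooth :: "'e::finite vfield \<Rightarrow> bool" where
  "smooth g \<longleftrightarrow> (\<forall>is x. foldr partial is g differentiable (at x))"

definition smooth_bounded :: "'e::finite vfield \<Rightarrow> bool" where
  "smooth_bounded g \<longleftrightarrow> smooth g \<and> (\<forall>is. bounded (range (foldr partial is g)))"

text \<open>
  \<open>vf_act f g\<close> is the derivative \<open>\<Sum>\<^sub>i f\<^sup>i \<partial>\<^sub>i g\<close> of \<open>g\<close> along \<open>f\<close>: both \<open>f \<triangleleft> g\<close> and the result of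
  letting \<open>f\<close> act on \<open>g\<close> as a differential operator.
\<close>

definition vf_act :: "'e::finite vfield \<Rightarrow> 'e vfield \<Rightarrow> 'e vfield" where
  "vf_act f g = (\<lambda>x. \<Sum>i\<in>UNIV. (f x $ i) *\<^sub>R partial i g x)"

definition proj_B :: "'d series \<Rightarrow> 'd series" where
  "proj_B h = (\<lambda>F. if \<exists>t. F = {#t#} then h F else 0)"

definition graft :: "'d series \<Rightarrow> 'd series \<Rightarrow> 'd series" where
  "graft g h = proj_B (g \<star> h)"

definition pre_lie_morphism :: "('d series \<Rightarrow> 'e::finite vfield) \<Rightarrow> bool" where
  "pre_lie_morphism \<Phi> \<longleftrightarrow>
     (\<forall>h \<in> B_trees. smooth (\<Phi> h)) \<and>
     (\<forall>g \<in> B_trees. \<forall>h \<in> B_trees. \<forall>a b.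
        \<Phi> (\<lambda>F. a * g F + b * h F) = (\<lambda>x. a *\<^sub>R \<Phi> g x + b *\<^sub>R \<Phi> h x)) \<and>
     (\<forall>g \<in> B_trees. \<forall>h \<in> B_trees. \<Phi> (graft g h) = vf_act (\<Phi> g) (\<Phi> h))"


section \<open>Solutions of rough differential equations\<close>

text \<open>
  Small-o moduli. The clause \<open>\<theta> 0 = 0\<close> makes a remainder \<open>o(\<omega>(s,t))\<close> vanish where
  \<open>\<omega>(s,t) = 0\<close>, which the limit alone does not express.
\<close>

definition little_o_modulus :: "(real \<Rightarrow> real) \<Rightarrow> bool" where
  "little_o_modulus \<theta> \<longleftrightarrow> \<theta> 0 = 0 \<and> ((\<lambda>x. \<theta> x / x) \<longlongrightarrow> 0) (at_right 0)"

definition euler_path ::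
  "(real \<Rightarrow> real \<Rightarrow> real) \<Rightarrow> (real \<Rightarrow> real \<Rightarrow> 'e::finite vfield) \<Rightarrow> real ^ 'e \<Rightarrow> (real \<Rightarrow> real ^ 'e) \<Rightarrow> bool" where
  "euler_path \<omega> E y Y \<longleftrightarrow>
     continuous_on {0..1} Y \<and> Y 0 = y \<and>
     (\<exists>\<theta>. little_o_modulus \<theta> \<and>
        (\<forall>(s, t) \<in> time_triangle. norm (Y t - Y s - E s t (Y s)) \<le> \<theta> (\<omega> s t)))"

definition unique_euler_path ::
  "(real \<Rightarrow> real \<Rightarrow> real) \<Rightarrow> (real \<Rightarrow> real \<Rightarrow> 'e::finite vfield) \<Rightarrow> real ^ 'e \<Rightarrow> (real \<Rightarrow> real ^ 'e) \<Rightarrow> bool" where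
  "unique_euler_path \<omega> E y Y \<longleftrightarrow>
     euler_path \<omega> E y Y \<and> (\<forall>Z. euler_path \<omega> E y Z \<longrightarrow> (\<forall>t \<in> {0..1}. Z t = Y t))"

text \<open>In the branched case the argument \<open>\<Phi>\<close> is the pre-Lie morphism \<open>\<tau> \<mapsto> f\<^sub>\<tau>\<close> induced by \<open>f\<close>.\<close>

definition solves_branched_RDE ::
  "real \<Rightarrow> (real \<Rightarrow> real \<Rightarrow> real) \<Rightarrow> (real \<Rightarrow> real \<Rightarrow> 'd::finite series) \<Rightarrow>
   ('d series \<Rightarrow> 'e::finite vfield) \<Rightarrow> real ^ 'e \<Rightarrow> (real \<Rightarrow> real ^ 'e) \<Rightarrow> bool" where
  "solves_branched_RDE p \<omega> X \<Phi> y Y \<longleftrightarrow>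
     unique_euler_path \<omega>
       (\<lambda>s t x. \<Sum>\<tau> | nodes \<tau> \<le> nat \<lfloor>p\<rfloor>. X s t {#\<tau>#} *\<^sub>R \<Phi> (ser {#\<tau>#}) x) y Y"

definition solves_geometric_RDE ::
  "real \<Rightarrow> (nat \<Rightarrow> 'd rtree) \<Rightarrow> nat \<Rightarrow> (real \<Rightarrow> real \<Rightarrow> real) \<Rightarrow> (real \<Rightarrow> real \<Rightarrow> words) \<Rightarrow>
   (nat \<Rightarrow> 'e::finite vfield) \<Rightarrow> real ^ 'e \<Rightarrow> (real \<Rightarrow> real ^ 'e) \<Rightarrow> bool" where
  "solves_geometric_RDE p \<tau> k \<omega> Xbar fbar y Y \<longleftrightarrow>
     unique_euler_path \<omega>
       (\<lambda>s t x. \<Sum>R \<in> A_Pi p \<tau> k - {[]}.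
          Xbar s t R *\<^sub>R foldr (\<lambda>r g. vf_act (fbar r) g) R (\<lambda>z. z) x) y Y"

end

theory Submission
  imports Defs
begin

text \<open>
  The two equations have literally the same Euler expansion: for all \<open>(s, t)\<close> and \<open>x\<close> the increment
  \<open>\<Sum>\<^sub>\<tau> \<langle>X\<^sub>s\<^sub>,\<^sub>t, \<tau>\<rangle> f\<^sub>\<tau>(x)\<close> equals \<open>\<Sum>\<^sub>R \<langle>\<Psi>(X\<^sub>s\<^sub>,\<^sub>t), R\<rangle> (f\<^sub>r\<^sub>1 \<cdots> f\<^sub>r\<^sub>m I)(x)\<close>. Since a solution is
  characterised by its Euler expansion and the same control appears on both sides, the
  solutions coincide, with no analysis involved.

  To compare the increments, apply the inverse of \<open>\<Psi>\<close>: \<open>X\<^sub>s\<^sub>,\<^sub>t\<close> is the combination of the products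
  \<open>\<tau>\<^sub>r\<^sub>1 \<star> \<dots> \<star> \<tau>\<^sub>r\<^sub>m\<close> with the coefficients of \<open>\<Psi>(X\<^sub>s\<^sub>,\<^sub>t)\<close> (\<open>Psi_expansion\<close>). The branched increment
  only sees the single-tree part of such a product, so what has to be shown is that the pre-Lie
  morphism sends \<open>\<pi>\<^sub>\<B>(\<tau>\<^sub>r\<^sub>1 \<star> \<dots> \<star> \<tau>\<^sub>r\<^sub>m)\<close> to the iterated derivative \<open>f\<^sub>r\<^sub>1 \<cdots> f\<^sub>r\<^sub>m I\<close> of the identity
  (\<open>pre_lie_morphism_star_word\<close>).

  The combinatorial reason is that an admissible cut of a tree leaves a trunk that is either empty
  or again a single tree. Hence \<open>\<pi>\<^sub>\<B>(g \<star> h)\<close> depends on \<open>h\<close> only through its counit and its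
  single-tree part (\<open>proj_B_star\<close>), so that
  \<open>\<pi>\<^sub>\<B>(\<tau>\<^sub>r\<^sub>1 \<star> \<dots> \<star> \<tau>\<^sub>r\<^sub>m) = \<tau>\<^sub>r\<^sub>1 \<curvearrowright> (\<tau>\<^sub>r\<^sub>2 \<curvearrowright> (\<dots> \<curvearrowright> \<tau>\<^sub>r\<^sub>m))\<close>. The morphism turns each grafting into a
  derivative, and the innermost \<open>f\<^sub>r\<^sub>m\<close> is the derivative of the identity along itself.
\<close>

section \<open>Keys of the Connes--Kreimer coproduct\<close>

lemma keys_id_tensor_B:
  assumes "(a, b) \<in> Poly_Mapping.keys (id_tensor_B i P)"
  obtains c where "b = {#Node i c#}" "(a, c) \<in> Poly_Mapping.keys P"
proof -
  have "(a, b) \<in> (\<Union>q\<in>Poly_Mapping.keys P. Poly_Mapping.keys (case q of (a, b) \<Rightarrow>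
          Poly_Mapping.single (a, {#Node i b#}) (Poly_Mapping.lookup P (a, b))))"
    using assms unfolding id_tensor_B_def by (rule subsetD[OF Poly_Mapping.keys_sum])
  with that show thesis by (auto split: if_splits)
qed

lemma keys_prod_graded:
  assumes "\<And>t a b. t \<in># F \<Longrightarrow> (a, b) \<in> Poly_Mapping.keys (g t) \<Longrightarrow> fnodes a + fnodes b = nodes t"
    and "(a, b) \<in> Poly_Mapping.keys (\<Prod>\<^sub># (image_mset g F))"
  shows "fnodes a + fnodes b = fnodes F"
  using assms
proof (induction F arbitrary: a b)
  case empty
  then show ?case by (auto simp: fnodes_def zero_prod_def split: if_splits)
next
  case (add t F)
  have "(a, b) \<in> Poly_Mapping.keys (g t * \<Prod>\<^sub># (image_mset g F))"
    using add.prems(2) by simp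
  then obtain q r where "q \<in> Poly_Mapping.keys (g t)"
    "r \<in> Poly_Mapping.keys (\<Prod>\<^sub># (image_mset g F))" "(a, b) = q + r"
    using keys_mult by blast
  then obtain a1 b1 a2 b2 where "(a1, b1) \<in> Poly_Mapping.keys (g t)"
    and "(a2, b2) \<in> Poly_Mapping.keys (\<Prod>\<^sub># (image_mset g F))" "a = a1 + a2" "b = b1 + b2"
    by (cases q; cases r) auto
  moreover from this have "fnodes a1 + fnodes b1 = nodes t" "fnodes a2 + fnodes b2 = fnodes F"
    using add.prems(1) add.IH by auto
  ultimately show ?case by (simp add: fnodes_def)
qed

lemma keys_CK_tree_graded:
  "(a, b) \<in> Poly_Mapping.keys (CK_tree t) \<Longrightarrow> fnodes a + fnodes b = nodes t"
proof (induction t arbitrary: a b)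
  case (Node i F)
  then consider "(a, b) \<in> Poly_Mapping.keys (Poly_Mapping.single ({#Node i F#}, {#}) (1::real))"
    | "(a, b) \<in> Poly_Mapping.keys (id_tensor_B i (\<Prod>\<^sub># (image_mset CK_tree F)))"
    using Poly_Mapping.keys_add by (metis (no_types, lifting) CK_tree.simps Un_iff subsetD)
  then show ?case
  proof cases
    case 1
    then show ?thesis by (simp add: fnodes_def)
  next
    case 2
    then obtain c where "b = {#Node i c#}"
      and "(a, c) \<in> Poly_Mapping.keys (\<Prod>\<^sub># (image_mset CK_tree F))"
      by (rule keys_id_tensor_B)
    with keys_prod_graded[OF Node.IH] show ?thesis by (simp add: fnodes_def)
  qed
qed

lemma keys_CK_graded:
  "(a, b) \<in> Poly_Mapping.keys (CK F) \<Longrightarrow> fnodes a + fnodes b = fnodes F"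
  unfolding CK_def by (rule keys_prod_graded[OF keys_CK_tree_graded])

text \<open>
  The trunk left by an admissible cut contains the root, hence is a single tree, except for the
  total cut, which leaves nothing. This distinguishes trees from forests, whose cuts can leave
  several trees.
\<close>

lemma lookup_CK_tree_empty_trunk:
  "Poly_Mapping.lookup (CK_tree t) (a, {#}) = (if a = {#t#} then 1 else 0)"
proof (cases t)
  case (Node i F)
  have "(a, {#}) \<notin> Poly_Mapping.keys (id_tensor_B i (\<Prod>\<^sub># (image_mset CK_tree F)))"
    by (auto elim: keys_id_tensor_B)
  then have "Poly_Mapping.lookup (id_tensor_B i (\<Prod>\<^sub># (image_mset CK_tree F))) (a, {#}) = 0"
    by (simp add: in_keys_iff)
  then show ?thesis
    using Node by (auto simp: lookup_add lookup_single when_def)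
qed

lemma keys_CK_tree_trunk:
  assumes "(a, b) \<in> Poly_Mapping.keys (CK_tree t)"
  shows "b = {#} \<or> (\<exists>u. b = {#u#})"
proof (cases t)
  case (Node i F)
  with assms have "(a, b) \<in> Poly_Mapping.keys (Poly_Mapping.single ({#Node i F#}, {#}) (1::real))
    \<union> Poly_Mapping.keys (id_tensor_B i (\<Prod>\<^sub># (image_mset CK_tree F)))"
    using Poly_Mapping.keys_add by (metis (no_types, lifting) CK_tree.simps subsetD)
  then show ?thesis by (auto elim: keys_id_tensor_B)
qed


section \<open>The single-tree part of a star product\<close>

lemma star_empty_forest: "(g \<star> h) {#} = g {#} * h {#}"
  by (simp add: star_def CK_def lookup_one zero_prod_def)

lemma star_graded:
  assumes "(g \<star> h) F \<noteq> 0"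
  obtains a b where "g a \<noteq> 0" "h b \<noteq> 0" "fnodes a + fnodes b = fnodes F"
proof -
  obtain q where q: "q \<in> Poly_Mapping.keys (CK F)"
    "(case q of (a, b) \<Rightarrow> Poly_Mapping.lookup (CK F) (a, b) * (g a * h b)) \<noteq> 0"
    using assms unfolding star_def by (rule sum.not_neutral_contains_not_neutral)
  obtain a b where "q = (a, b)" by (cases q)
  with q show thesis by (intro that[of a b] keys_CK_graded) auto
qed

text \<open>
  Only the total cut contributes to the first term and only cuts with a single tree as trunk to the
  second. For a general forest in place of the single trees that \<^const>\<open>proj_B\<close> keeps,
  other parts of \<open>h\<close> would enter.
\<close>

lemma proj_B_star: "proj_B (g \<star> h) = (\<lambda>F. h {#} * proj_B g F + graft g (proj_B h) F)"
proof
  fix F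
  show "proj_B (g \<star> h) F = h {#} * proj_B g F + graft g (proj_B h) F"
  proof (cases "\<exists>t. F = {#t#}")
    case True
    then obtain t where F: "F = {#t#}" by blast
    let ?K = "Poly_Mapping.keys (CK_tree t)" and ?c = "Poly_Mapping.lookup (CK_tree t)"
    have split: "?c (a, b) * (g a * h b) =
        (if (a, b) = ({#t#}, {#}) then g {#t#} * h {#} else 0) + ?c (a, b) * (g a * proj_B h b)"
      if "(a, b) \<in> ?K" for a b
      using keys_CK_tree_trunk[OF that] by (auto simp: lookup_CK_tree_empty_trunk proj_B_def)
    have "({#t#}, {#}) \<in> ?K"
      by (simp add: in_keys_iff lookup_CK_tree_empty_trunk)
    then have "(\<Sum>q\<in>?K. if q = ({#t#}, {#}) then g {#t#} * h {#} else 0) = g {#t#} * h {#}"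
      by (simp add: sum.delta)
    moreover have "(\<Sum>(a, b)\<in>?K. ?c (a, b) * (g a * h b)) =
        (\<Sum>q\<in>?K. (if q = ({#t#}, {#}) then g {#t#} * h {#} else 0) +
          (case q of (a, b) \<Rightarrow> ?c (a, b) * (g a * proj_B h b)))"
      by (rule sum.cong[OF refl]) (clarify, simp only: prod.case split)
    moreover have "proj_B (g \<star> h) F = (\<Sum>(a, b)\<in>?K. ?c (a, b) * (g a * h b))"
      by (simp add: F proj_B_def star_def CK_def)
    moreover have "graft g (proj_B h) F = (\<Sum>(a, b)\<in>?K. ?c (a, b) * (g a * proj_B h b))"
      by (simp add: F graft_def proj_B_def[of "_ \<star> _"]) (simp add: star_def CK_def)
    moreover have "proj_B g F = g {#t#}"
      by (simp add: F proj_B_def)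
    ultimately show ?thesis by (simp add: sum.distrib mult.commute)
  next
    case False
    then show ?thesis by (simp add: proj_B_def graft_def)
  qed
qed

lemma star_word_graded: "star_word \<tau> R F \<noteq> 0 \<Longrightarrow> fnodes F = (\<Sum>r\<leftarrow>R. nodes (\<tau> r))"
proof (induction R arbitrary: F)
  case Nil
  then show ?case by (auto simp: star_word_def ser_def fnodes_def split: if_splits)
next
  case (Cons r R)
  have "(ser {#\<tau> r#} \<star> star_word \<tau> R) F \<noteq> 0"
    using Cons.prems by (simp add: star_word_def)
  then obtain a b where "ser {#\<tau> r#} a \<noteq> 0" "star_word \<tau> R b \<noteq> 0" "fnodes a + fnodes b = fnodes F"
    by (rule star_graded)
  with Cons.IH show ?case by (auto simp: ser_def fnodes_def split: if_splits)
qed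

lemma proj_B_in_B_trees:
  fixes h :: "'d::finite series"
  assumes "\<And>F. h F \<noteq> 0 \<Longrightarrow> fnodes F \<le> N"
  shows "proj_B h \<in> B_trees"
proof -
  have "{F. proj_B h F \<noteq> 0} \<subseteq> {F. fnodes F \<le> N}"
    using assms by (auto simp: proj_B_def split: if_splits)
  then have "finite {F. proj_B h F \<noteq> 0}"
    using finite_forests finite_subset by blast
  then show ?thesis by (auto simp: B_trees_def H_fin_def proj_B_def)
qed

lemma proj_B_star_word_in_B_trees:
  fixes \<tau> :: "nat \<Rightarrow> 'd::finite rtree"
  shows "proj_B (star_word \<tau> R) \<in> B_trees"
  by (rule proj_B_in_B_trees[where N = "\<Sum>r\<leftarrow>R. nodes (\<tau> r)"]) (simp add: star_word_graded)

lemma ser_tree_in_B_trees: "ser {#t#} \<in> B_trees"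
  by (auto simp: B_trees_def H_fin_def ser_def)

lemma proj_B_ser_tree: "proj_B (ser {#t#}) = ser {#t#}"
  by (auto simp: proj_B_def ser_def)

lemma proj_B_star_word_single:
  fixes \<tau> :: "nat \<Rightarrow> 'd rtree"
  shows "proj_B (star_word \<tau> [r]) = ser {#\<tau> r#}"
proof -
  have "proj_B (ser {#}) = ((\<lambda>_. 0) :: 'd series)"
    by (auto simp: proj_B_def ser_def)
  moreover have "graft g (\<lambda>_. 0) = (\<lambda>_. 0)" for g :: "'d series"
    by (auto simp: graft_def proj_B_def star_def)
  ultimately show ?thesis
    by (simp add: star_word_def proj_B_star proj_B_ser_tree) (simp add: ser_def)
qed

lemma proj_B_star_word_Cons:
  assumes "R \<noteq> []"
  shows "proj_B (star_word \<tau> (r # R)) = graft (ser {#\<tau> r#}) (proj_B (star_word \<tau> R))"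
proof -
  obtain r' R' where "R = r' # R'" using assms by (cases R) auto
  then have "star_word \<tau> R {#} = 0"
    by (simp add: star_word_def star_empty_forest) (simp add: ser_def)
  moreover have "star_word \<tau> (r # R) = ser {#\<tau> r#} \<star> star_word \<tau> R"
    by (simp add: star_word_def)
  ultimately show ?thesis by (simp add: proj_B_star)
qed


section \<open>Vector fields of star products\<close>

lemma vf_act_identity:
  fixes f :: "'e::finite vfield"
  shows "vf_act f (\<lambda>z. z) = f"
proof
  fix x
  have "partial i (\<lambda>z. z) x = axis i 1" for i :: 'e
    by (simp add: partial_def frechet_derivative_ident)
  then have "vf_act f (\<lambda>z. z) x = (\<Sum>i\<in>UNIV. (f x $ i) *\<^sub>R axis i 1)"
    by (simp add: vf_act_def)
  also have "\<dots> = f x"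
    by (simp add: vec_eq_iff axis_def if_distrib sum.delta cong: if_cong)
  finally show "vf_act f (\<lambda>z. z) x = f x" .
qed

lemma pre_lie_morphism_sum:
  fixes \<Phi> :: "'d series \<Rightarrow> 'e::finite vfield"
  assumes "pre_lie_morphism \<Phi>" "finite A"
  shows "(\<lambda>F. \<Sum>t\<in>A. c t * ser {#t#} F) \<in> B_trees \<and>
    \<Phi> (\<lambda>F. \<Sum>t\<in>A. c t * ser {#t#} F) = (\<lambda>x. \<Sum>t\<in>A. c t *\<^sub>R \<Phi> (ser {#t#}) x)"
  using assms(2)
proof (induction A rule: finite_induct)
  have lin: "\<Phi> (\<lambda>F. a * g F + b * h F) = (\<lambda>x. a *\<^sub>R \<Phi> g x + b *\<^sub>R \<Phi> h x)"
    if "g \<in> B_trees" "h \<in> B_trees" for g h a b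
    using assms(1) that by (simp add: pre_lie_morphism_def)
  {
    case empty
    have "((\<lambda>_. 0) :: 'd series) \<in> B_trees" by (simp add: B_trees_def H_fin_def)
    with lin[of "\<lambda>_. 0" "\<lambda>_. 0" 0 0] show ?case by simp
  next
    case (insert t A)
    let ?h = "\<lambda>F. \<Sum>t\<in>A. c t * ser {#t#} F"
    have h: "?h \<in> B_trees" using insert.IH by blast
    have "\<Phi> (\<lambda>F. c t * ser {#t#} F + 1 * ?h F) = (\<lambda>x. c t *\<^sub>R \<Phi> (ser {#t#}) x + 1 *\<^sub>R \<Phi> ?h x)"
      by (rule lin[OF ser_tree_in_B_trees h])
    moreover have "(\<lambda>F. c t * ser {#t#} F + ?h F) \<in> B_trees"
    proof -
      have "{F. c t * ser {#t#} F + ?h F \<noteq> 0} \<subseteq> insert {#t#} {F. ?h F \<noteq> 0}"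
        by (auto simp: ser_def)
      then show ?thesis
        using h by (auto simp: B_trees_def H_fin_def ser_def intro: finite_subset split: if_splits)
    qed
    ultimately show ?case using insert by simp
  }
qed

text \<open>
  The bound on the support is what makes the truncated sum, the only part that a path in a
  truncated group sees, capture all of the single-tree part of \<open>h\<close>.
\<close>

lemma pre_lie_morphism_proj_B:
  fixes \<Phi> :: "'d::finite series \<Rightarrow> 'e::finite vfield"
  assumes "pre_lie_morphism \<Phi>" "\<And>F. h F \<noteq> 0 \<Longrightarrow> fnodes F \<le> N"
  shows "\<Phi> (proj_B h) x = (\<Sum>t | nodes t \<le> N. h {#t#} *\<^sub>R \<Phi> (ser {#t#}) x)"
proof -
  have fin: "finite {t :: 'd rtree. nodes t \<le> N}" by (rule finite_trees)
  have "proj_B h F = (\<Sum>t | nodes t \<le> N. h {#t#} * ser {#t#} F)" for F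
  proof (cases "\<exists>u. F = {#u#}")
    case True
    then obtain u where F: "F = {#u#}" by blast
    have "(\<Sum>t | nodes t \<le> N. h {#t#} * ser {#t#} F) =
        (\<Sum>t | nodes t \<le> N. if t = u then h {#u#} else 0)"
      by (rule sum.cong) (auto simp: F ser_def)
    also have "\<dots> = (if nodes u \<le> N then h {#u#} else 0)"
      using fin by (simp add: sum.delta)
    also have "\<dots> = proj_B h F"
      using assms(2)[of F] by (auto simp: F proj_B_def fnodes_def)
    finally show ?thesis by simp
  next
    case False
    then show ?thesis by (auto simp: proj_B_def ser_def intro!: sum.neutral[symmetric])
  qed
  then have "proj_B h = (\<lambda>F. \<Sum>t | nodes t \<le> N. h {#t#} * ser {#t#} F)" by blast
  with pre_lie_morphism_sum[OF assms(1) fin, of "\<lambda>t. h {#t#}"] show ?thesis by simp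
qed

text \<open>
  A word of tree generators acts on vector fields through its single-tree part: each further
  letter grafts onto the trees already present, and grafting becomes differentiation.
\<close>

lemma pre_lie_morphism_star_word:
  fixes \<tau> :: "nat \<Rightarrow> 'd::finite rtree"
  assumes "pre_lie_morphism \<Phi>" "\<And>r. r \<in> set R \<Longrightarrow> fbar r = \<Phi> (ser {#\<tau> r#})" "R \<noteq> []"
  shows "\<Phi> (proj_B (star_word \<tau> R)) = foldr (\<lambda>r g. vf_act (fbar r) g) R (\<lambda>z. z)"
  using assms(2,3)
proof (induction R)
  case (Cons r R)
  show ?case
  proof (cases "R = []")
    case True
    then show ?thesis using Cons.prems by (simp add: proj_B_star_word_single vf_act_identity)
  next
    case False
    have "\<Phi> (proj_B (star_word \<tau> (r # R))) = vf_act (\<Phi> (ser {#\<tau> r#})) (\<Phi> (proj_B (star_word \<tau> R)))"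
      using assms(1) ser_tree_in_B_trees[of "\<tau> r"] proj_B_star_word_in_B_trees[of \<tau> R]
      by (simp add: proj_B_star_word_Cons[OF False] pre_lie_morphism_def)
    then show ?thesis using Cons False by simp
  qed
qed simp


section \<open>Equality of the Euler expansions\<close>

lemma A_Pi_nodes:
  assumes "1 \<le> p" "R \<in> A_Pi p \<tau> k"
  shows "(\<Sum>r\<leftarrow>R. nodes (\<tau> r)) \<le> nat \<lfloor>p\<rfloor>"
proof -
  have "deg_Pi p \<tau> R = real (\<Sum>r\<leftarrow>R. nodes (\<tau> r)) / p" for R
    by (induction R) (simp_all add: deg_Pi_def add_divide_distrib)
  with assms have "real (\<Sum>r\<leftarrow>R. nodes (\<tau> r)) \<le> p" by (simp add: A_Pi_def divide_le_eq)
  then show ?thesis by (rule le_nat_floor)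
qed

lemma Psi_sum:
  fixes \<Psi> :: "'d series \<Rightarrow> words"
  assumes "is_Psi p \<tau> k \<Psi>" "finite A" "A \<subseteq> lists {1..k}"
  shows "(\<lambda>F. \<Sum>R\<in>A. c R * rho (nat \<lfloor>p\<rfloor>) (star_word \<tau> R) F) \<in> H_trunc (nat \<lfloor>p\<rfloor>) \<and>
    \<Psi> (\<lambda>F. \<Sum>R\<in>A. c R * rho (nat \<lfloor>p\<rfloor>) (star_word \<tau> R) F) =
      (\<lambda>S. \<Sum>R\<in>A. c R * trunc_Pi p \<tau> k (word R) S)"
  using assms(2,3)
proof (induction A rule: finite_induct)
  let ?N = "nat \<lfloor>p\<rfloor>"
  have trunc: "h \<in> H_trunc ?N \<longleftrightarrow> (\<forall>F. ?N < fnodes F \<longrightarrow> h F = 0)" for h :: "'d series"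
    by (auto simp: H_trunc_def rho_def image_iff intro!: exI[of _ h])
  have lin: "\<Psi> (\<lambda>F. a * g F + b * h F) = (\<lambda>R. a * \<Psi> g R + b * \<Psi> h R)"
    if "g \<in> H_trunc ?N" "h \<in> H_trunc ?N" for g h a b
    using assms(1) that by (simp add: is_Psi_def Let_def)
  {
    case empty
    have "((\<lambda>_. 0) :: 'd series) \<in> H_trunc ?N" by (simp add: trunc)
    with lin[of "\<lambda>_. 0" "\<lambda>_. 0" 0 0] show ?case by simp
  next
    case (insert R A)
    let ?h = "\<lambda>F. \<Sum>R\<in>A. c R * rho ?N (star_word \<tau> R) F"
    have h: "?h \<in> H_trunc ?N" using insert by blast
    have w: "rho ?N (star_word \<tau> R) \<in> H_trunc ?N" by (simp add: H_trunc_def)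
    have "\<Psi> (rho ?N (star_word \<tau> R)) = trunc_Pi p \<tau> k (word R)"
      using assms(1) insert.prems unfolding is_Psi_def Let_def by blast
    with lin[OF w h, of "c R" 1] insert h w show ?case by (simp add: trunc)
  }
qed

text \<open>
  The inverse of \<open>\<Psi>\<close> in coordinates: the star products along the words in \<^const>\<open>A_Pi\<close> form a basis of the
  truncated algebra, because \<open>\<Psi>\<close> maps them to the standard basis.
\<close>

lemma Psi_expansion:
  assumes "1 \<le> p" "is_Psi p \<tau> k \<Psi>" "h \<in> H_trunc (nat \<lfloor>p\<rfloor>)"
  shows "h = (\<lambda>F. \<Sum>R\<in>A_Pi p \<tau> k. \<Psi> h R * rho (nat \<lfloor>p\<rfloor>) (star_word \<tau> R) F)" (is "h = ?h")
proof -
  have fin: "finite (A_Pi p \<tau> k)" using assms(1) by (simp add: finite_A_Pi)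
  have bij: "bij_betw \<Psi> (H_trunc (nat \<lfloor>p\<rfloor>)) (T_Pi p \<tau> k)"
    using assms(2) by (simp add: is_Psi_def Let_def)
  have "A_Pi p \<tau> k \<subseteq> lists {1..k}" by (auto simp: A_Pi_def)
  note sum = Psi_sum[OF assms(2) fin this, of "\<Psi> h"]
  have "\<Psi> h \<in> T_Pi p \<tau> k" using bij assms(3) by (rule bij_betwE[rule_format])
  then have "\<Psi> h S = (\<Sum>R\<in>A_Pi p \<tau> k. \<Psi> h R * trunc_Pi p \<tau> k (word R) S)" for S
  proof (cases "S \<in> A_Pi p \<tau> k")
    case True
    have "(\<Sum>R\<in>A_Pi p \<tau> k. \<Psi> h R * trunc_Pi p \<tau> k (word R) S) =
        (\<Sum>R\<in>A_Pi p \<tau> k. if S = R then \<Psi> h R else 0)"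
      using True by (intro sum.cong) (auto simp: trunc_Pi_def word_def)
    then show ?thesis using True fin by simp
  next
    case False
    with \<open>\<Psi> h \<in> T_Pi p \<tau> k\<close> show ?thesis by (simp add: T_Pi_def trunc_Pi_def)
  qed
  then have "\<Psi> h = (\<lambda>S. \<Sum>R\<in>A_Pi p \<tau> k. \<Psi> h R * trunc_Pi p \<tau> k (word R) S)"
    by (rule ext)
  then have "\<Psi> h = \<Psi> ?h"
    by (rule trans[OF _ conjunct2[OF sum, symmetric]])
  then show ?thesis
    by (rule inj_onD[OF bij_betw_imp_inj_on[OF bij] _ assms(3) conjunct1[OF sum]])
qed

lemma euler_expansions_agree:
  fixes h :: "'d::finite series" and \<Phi> :: "'d series \<Rightarrow> 'e::finite vfield"
  assumes "1 \<le> p" "is_Psi p \<tau> k \<Psi>" "h \<in> H_trunc (nat \<lfloor>p\<rfloor>)" "pre_lie_morphism \<Phi>"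
    and fbar: "\<And>j. j \<in> {1..k} \<Longrightarrow> fbar j = \<Phi> (ser {#\<tau> j#})"
  shows "(\<Sum>t | nodes t \<le> nat \<lfloor>p\<rfloor>. h {#t#} *\<^sub>R \<Phi> (ser {#t#}) x) =
    (\<Sum>R \<in> A_Pi p \<tau> k - {[]}. \<Psi> h R *\<^sub>R foldr (\<lambda>r g. vf_act (fbar r) g) R (\<lambda>z. z) x)"
proof -
  let ?N = "nat \<lfloor>p\<rfloor>" and ?A = "A_Pi p \<tau> k"
  have fin: "finite ?A" using assms(1) by (simp add: finite_A_Pi)
  have coeff: "h {#t#} = (\<Sum>R\<in>?A - {[]}. \<Psi> h R * star_word \<tau> R {#t#})" if "nodes t \<le> ?N" for t
  proof -
    have "h {#t#} = (\<Sum>R\<in>?A. \<Psi> h R * rho ?N (star_word \<tau> R) {#t#})"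
      using Psi_expansion[OF assms(1-3)] by (rule fun_cong)
    also have "\<dots> = (\<Sum>R\<in>?A. \<Psi> h R * star_word \<tau> R {#t#})"
      using that by (simp add: rho_def fnodes_def)
    \<comment> \<open>The empty word is the empty forest, which has no single-tree part.\<close>
    also have "\<dots> = (\<Sum>R\<in>?A - {[]}. \<Psi> h R * star_word \<tau> R {#t#})"
      using fin by (intro sum.mono_neutral_right) (auto simp: star_word_def ser_def)
    finally show ?thesis .
  qed
  have "(\<Sum>t | nodes t \<le> ?N. h {#t#} *\<^sub>R \<Phi> (ser {#t#}) x) =
      (\<Sum>t | nodes t \<le> ?N. \<Sum>R\<in>?A - {[]}. \<Psi> h R *\<^sub>R star_word \<tau> R {#t#} *\<^sub>R \<Phi> (ser {#t#}) x)"
    by (rule sum.cong) (simp_all add: coeff scaleR_sum_left)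
  also have "\<dots> = (\<Sum>R\<in>?A - {[]}. \<Psi> h R *\<^sub>R
      (\<Sum>t | nodes t \<le> ?N. star_word \<tau> R {#t#} *\<^sub>R \<Phi> (ser {#t#}) x))"
    by (subst sum.swap) (simp add: scaleR_sum_right)
  also have "\<dots> = (\<Sum>R\<in>?A - {[]}. \<Psi> h R *\<^sub>R foldr (\<lambda>r g. vf_act (fbar r) g) R (\<lambda>z. z) x)"
  proof (rule sum.cong[OF refl])
    fix R assume R: "R \<in> ?A - {[]}"
    then have "fnodes F \<le> ?N" if "star_word \<tau> R F \<noteq> 0" for F
      using star_word_graded[OF that] A_Pi_nodes[OF assms(1), of R \<tau> k] by simp
    then have "(\<Sum>t | nodes t \<le> ?N. star_word \<tau> R {#t#} *\<^sub>R \<Phi> (ser {#t#}) x) =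
        \<Phi> (proj_B (star_word \<tau> R)) x"
      by (rule pre_lie_morphism_proj_B[OF assms(4), symmetric])
    also have "\<Phi> (proj_B (star_word \<tau> R)) = foldr (\<lambda>r g. vf_act (fbar r) g) R (\<lambda>z. z)"
      using R by (intro pre_lie_morphism_star_word[OF assms(4)] fbar) (auto simp: A_Pi_def)
    finally show "\<Psi> h R *\<^sub>R (\<Sum>t | nodes t \<le> ?N. star_word \<tau> R {#t#} *\<^sub>R \<Phi> (ser {#t#}) x) =
        \<Psi> h R *\<^sub>R foldr (\<lambda>r g. vf_act (fbar r) g) R (\<lambda>z. z) x"
      by simp
  qed
  finally show ?thesis .
qed

lemma unique_euler_path_cong:
  assumes "\<And>s t x. (s, t) \<in> time_triangle \<Longrightarrow> E s t x = E' s t x"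
  shows "unique_euler_path \<omega> E y Y \<longleftrightarrow> unique_euler_path \<omega> E' y Y"
proof -
  have "euler_path \<omega> E y Z \<longleftrightarrow> euler_path \<omega> E' y Z" for Z
    unfolding euler_path_def using assms by (auto simp: Ball_def)
  then show ?thesis by (simp add: unique_euler_path_def)
qed

theorem proposition4p9:
  fixes p :: real
    and X :: "real \<Rightarrow> real \<Rightarrow> 'd::finite series"
    and Xbar :: "real \<Rightarrow> real \<Rightarrow> words"
    and \<omega> :: "real \<Rightarrow> real \<Rightarrow> real"
    and \<tau> :: "nat \<Rightarrow> 'd rtree" and k :: nat
    and \<Psi> :: "'d series \<Rightarrow> words"
    and f :: "'d \<Rightarrow> 'e::finite vfield"
    and \<Phi> :: "'d series \<Rightarrow> 'e vfield"
    and fbar :: "nat \<Rightarrow> 'e vfield"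
    and y :: "real ^ 'e"
  assumes "1 \<le> p"
    and "free_generators \<tau>" and "is_cutoff p \<tau> k"
    and "branched_rough_path p X"
    and "is_Psi p \<tau> k \<Psi>"
    and "\<And>s t. (s, t) \<in> time_triangle \<Longrightarrow> Xbar s t = \<Psi> (X s t)"
    and "weakly_geometric_rough_path p \<tau> k Xbar"
    and "controls_p_variation p X \<omega>" and "controls_Pi_variation p \<tau> k Xbar \<omega>"
    and "\<And>i. smooth_bounded (f i)"
    and "pre_lie_morphism \<Phi>" and "\<And>i. \<Phi> (ser {#Node i {#}#}) = f i"
    and "\<And>j. j \<in> {1..k} \<Longrightarrow> fbar j = \<Phi> (ser {#\<tau> j#})"
  shows "(\<forall>Y. solves_branched_RDE p \<omega> X \<Phi> y Y \<longleftrightarrow> solves_geometric_RDE p \<tau> k \<omega> Xbar fbar y Y) \<and>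
         (\<forall>Y Ybar. solves_branched_RDE p \<omega> X \<Phi> y Y \<longrightarrow>
            solves_geometric_RDE p \<tau> k \<omega> Xbar fbar y Ybar \<longrightarrow> (\<forall>t \<in> {0..1}. Y t = Ybar t))"
proof -
  have "X s t \<in> H_trunc (nat \<lfloor>p\<rfloor>)" if "(s, t) \<in> time_triangle" for s t
    using assms(4) that by (auto simp: branched_rough_path_def G_trunc_def H_trunc_def)
  then have "solves_branched_RDE p \<omega> X \<Phi> y Y \<longleftrightarrow> solves_geometric_RDE p \<tau> k \<omega> Xbar fbar y Y" for Y
    unfolding solves_branched_RDE_def solves_geometric_RDE_def
    by (intro unique_euler_path_cong)
      (use euler_expansions_agree[OF assms(1,5) _ assms(11,13)] in \<open>simp add: assms(6)\<close>)
  moreover have "Y t = Ybar t"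
    if "solves_geometric_RDE p \<tau> k \<omega> Xbar fbar y Y"
      "solves_geometric_RDE p \<tau> k \<omega> Xbar fbar y Ybar" "t \<in> {0..1}" for Y Ybar t
    using that unfolding solves_geometric_RDE_def unique_euler_path_def by blast
  ultimately show ?thesis by blast
qed

end
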